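(* For every even integer $n\ge 8$, the total domination number of the $3$-regular Kn\"odel graph $W_{3,n}$ is $$\gamma_t(W_{3,n})=4\left\lceil \frac{n}{10}\right\rceil-\begin{cases}0 & \text{if } n\equiv 0,6,8 \pmod{10},\\ 2 & \text{if } n\equiv 2,4 \pmod{10}.\end{cases}$$
   Context: For an even integer $n\ge 2$ and an integer $1\le \Delta\le\lfloor\log_2 n\rfloor$, the Kn\"odel graph $W_{\Delta,n}$ is the bipartite graph with vertex set $\{(i,j): i\in\{1,2\},\ 0\le j\le n/2-1\}$, where for every $j$ with $0\le j\le n/2-1$ the vertex $(1,j)$ is adjacent to the vertices $(2,(j+2^k-1)\bmod (n/2))$ for $k=0,1,\dots,\Delta-1$, and there are no other edges; it is $\Delta$-regular of order $n$. A set $D$ of vertices of a graph $G$ is a total dominating set if every vertex of $G$ (including those in $D$) is adjacent to some vertex of $D$; the total domination number $\gamma_t(G)$ is the minimum cardinality of a total dominating set of $G$. *)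

theory Defs
  imports Complex_Main
begin

text \<open>
  A simple graph is given by its vertex set \<open>V\<close> and its edge set \<open>E\<close>, a set of two-element
  subsets of \<open>V\<close>.
\<close>

definition adjacent :: "'a set set \<Rightarrow> 'a \<Rightarrow> 'a \<Rightarrow> bool" where
  "adjacent E u v \<longleftrightarrow> {u, v} \<in> E"

definition total_dominating_set :: "'a set \<Rightarrow> 'a set set \<Rightarrow> 'a set \<Rightarrow> bool" where
  "total_dominating_set V E D \<longleftrightarrow> D \<subseteq> V \<and> (\<forall>v\<in>V. \<exists>u\<in>D. adjacent E v u)"

text \<open>
  Meaningful for finite graphs without isolated vertices; otherwise there is no total dominating
  set, or \<open>card\<close> may be applied to an infinite set.
\<close>

definition total_domination_number :: "'a set \<Rightarrow> 'a set set \<Rightarrow> nat" where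
  "total_domination_number V E = (LEAST m. \<exists>D. total_dominating_set V E D \<and> card D = m)"

definition knodel_verts :: "nat \<Rightarrow> (nat \<times> nat) set" where
  "knodel_verts n = {1, 2} \<times> {..<n div 2}"

text \<open>
  The Knoedel graph \<open>W\<^sub>\<Delta>\<^sub>,\<^sub>n\<close> is considered for even \<open>n \<ge> 2\<close> and \<open>1 \<le> \<Delta> \<le> \<lfloor>log 2 n\<rfloor>\<close>.
  The subtraction on \<open>nat\<close> is never truncated, since \<open>2 ^ k \<ge> 1\<close>.
\<close>

definition knodel_edges :: "nat \<Rightarrow> nat \<Rightarrow> (nat \<times> nat) set set" where
  "knodel_edges \<Delta> n =
     {{(1, j), (2, (j + 2 ^ k - 1) mod (n div 2))} | j k. j < n div 2 \<and> k < \<Delta>}"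

end

theory Submission
  imports Defs
begin

text \<open>
  With \<open>m = n div 2\<close>, a total dominating set splits into its two sides, each of which has to
  cover the cyclic group of order \<open>m\<close> by translates of \<open>{0, 1, 3}\<close> or of \<open>- {0, 1, 3}\<close>.
  The least size of such a cover is \<open>2 m / 5\<close>, rounded up. For the lower bound, no element \<open>s\<close> of a
  cover \<open>S\<close> is isolated: whichever element covers \<open>s + 2\<close>, one of the points \<open>s\<close>, \<open>s + 1\<close>,
  \<open>s + 3\<close> is covered at least twice. A point covered \<open>c \<ge> 2\<close> times has excess \<open>c - 1 \<ge> c / 2\<close>, so
  the total excess \<open>3 |S| - m\<close> is at least \<open>|S| / 2\<close>. The cover
  \<open>{0, 1, 5, 6, 10, 11, \<dots>}\<close>, suitably cut off, attains the bound.
\<close>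

section \<open>Covers of the integers modulo \<open>m\<close>\<close>

lemma sum_shift_periodic:
  fixes F :: "int \<Rightarrow> 'a::comm_monoid_add" and m k :: int
  assumes "m > 0" and per: "\<And>x. F (x mod m) = F x"
  shows "(\<Sum>x\<in>{0..<m}. F (x + k)) = (\<Sum>x\<in>{0..<m}. F x)"
proof (rule sum.reindex_bij_witness[where i = "\<lambda>x. (x - k) mod m" and j = "\<lambda>x. (x + k) mod m"])
  fix x assume x: "x \<in> {0..<m}"
  show "((x + k) mod m - k) mod m = x" using x by (simp add: mod_diff_left_eq)
  show "((x - k) mod m + k) mod m = x" using x by (simp add: mod_add_left_eq)
  show "(x + k) mod m \<in> {0..<m}" "(x - k) mod m \<in> {0..<m}" using \<open>m > 0\<close> by auto
  show "F ((x + k) mod m) = F (x + k)" by (rule per)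
qed

text \<open>The sign \<open>e\<close> lets one argument serve both sides of the graph:
  \<open>e = 1\<close> for translates of {0, 1, 3}, \<open>e = - 1\<close> for their negatives.
  Covering is counted with multiplicity, so coincidences between the three residues for small
  \<open>m\<close> do no harm.\<close>

lemma cyclic_cover_bound:
  fixes S :: "int set" and m e :: int
  assumes "m > 0" and S: "S \<subseteq> {0..<m}"
    and cover: "\<And>x. \<exists>d\<in>{0, 1, 3}. (x - e * d) mod m \<in> S"
  shows "2 * m \<le> 5 * int (card S)"
proof -
  define g :: "int \<Rightarrow> int" where "g x = (if x mod m \<in> S then 1 else 0)" for x
  define c where "c x = g x + g (x - e) + g (x - 3 * e)" for x
  define h :: "int \<Rightarrow> int" where "h x = (if c x \<ge> 2 then 1 else 0)" for x
  have per_g: "g (x mod m + k) = g (x + k)" "g (x mod m - k) = g (x - k)" "g (x mod m) = g x"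
    for x k
    by (simp_all add: g_def mod_add_left_eq mod_diff_left_eq)
  have per_h: "h (x mod m + k) = h (x + k)" "h (x mod m) = h x" for x k
    unfolding h_def c_def add_diff_eq[symmetric] per_g by simp_all
  have c_ge: "c x \<ge> 1" for x
    using cover[of x] by (auto simp: c_def g_def mult.commute)
  have shift: "(\<Sum>x\<in>{0..<m}. g (x - k)) = (\<Sum>x\<in>{0..<m}. g x)" for k
    using sum_shift_periodic[OF \<open>m > 0\<close>, of g "- k"] by (simp add: per_g)
  \<comment> \<open>Double counting: incidences of elements of \<open>S\<close> with multiply
    covered points are summed by element on the left, by point on the right.\<close>
  have shift_gh: "(\<Sum>x\<in>{0..<m}. g x * h (x + k)) = (\<Sum>x\<in>{0..<m}. g (x - k) * h x)" for k
    using sum_shift_periodic[OF \<open>m > 0\<close>, of "\<lambda>x. g (x - k) * h x" k] by (simp add: per_g per_h)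
  have "(\<Sum>x\<in>{0..<m}. g x) = (\<Sum>x\<in>S. 1)"
    using S by (intro sum.mono_neutral_cong_right) (auto simp: g_def)
  then have card: "(\<Sum>x\<in>{0..<m}. g x) = int (card S)" by simp
  have "g x \<le> g x * h x + g x * h (x + e) + g x * h (x + 3 * e)" for x
  proof -
    have "c x = g x + g (x - e) + g (x - 3 * e)"
      "c (x + e) = g (x + e) + g x + g (x - 2 * e)"
      "c (x + 2 * e) = g (x + 2 * e) + g (x + e) + g (x - e)"
      "c (x + 3 * e) = g (x + 3 * e) + g (x + 2 * e) + g x"
      by (simp_all add: c_def algebra_simps)
    \<comment> \<open>If \<open>g x = 1\<close> and \<open>c\<close> were 1 at \<open>x\<close>,
      \<open>x + e\<close> and \<open>x + 3 * e\<close>, then \<open>g\<close> would vanish at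
      \<open>x - e\<close>, \<open>x + e\<close> and \<open>x + 2 * e\<close>, leaving
      \<open>x + 2 * e\<close> uncovered.\<close>
    moreover have "g y \<ge> 0" for y by (simp add: g_def)
    note this[of "x + e"] this[of "x - e"] this[of "x + 2 * e"] this[of "x - 2 * e"]
      this[of "x + 3 * e"] this[of "x - 3 * e"]
    moreover note c_ge[of "x + 2 * e"]
    ultimately have "c x \<ge> 2 \<or> c (x + e) \<ge> 2 \<or> c (x + 3 * e) \<ge> 2" if "g x = 1"
      using that by linarith
    then show ?thesis by (cases "x mod m \<in> S") (auto simp: g_def h_def)
  qed
  then have "int (card S) \<le> (\<Sum>x\<in>{0..<m}. g x * h x + g x * h (x + e) + g x * h (x + 3 * e))"
    unfolding card[symmetric] by (intro sum_mono)
  also have "\<dots> = (\<Sum>x\<in>{0..<m}. c x * h x)"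
    by (simp add: sum.distrib shift_gh c_def distrib_right)
  \<comment> \<open>Both terms are 0 where \<open>c x = 1\<close>; elsewhere
    \<open>c x \<ge> 2\<close> gives \<open>c x \<le> 2 * (c x - 1)\<close>.\<close>
  also have "\<dots> \<le> (\<Sum>x\<in>{0..<m}. 2 * (c x - 1))"
    using c_ge by (intro sum_mono) (auto simp: h_def)
  also have "\<dots> = 2 * (3 * int (card S) - m)"
    using \<open>m > 0\<close>
    by (simp add: sum_distrib_left[symmetric] sum_subtractf c_def sum.distrib shift card)
  finally show ?thesis by simp
qed

text \<open>The sums of {0, 1} and {0, 1, 3} fill a block of five consecutive integers. There is no
  wrap-around: each point is reached from an element below or equal to it, so cutting off at
  \<open>m\<close> is harmless and the cover can later be reflected.\<close>

lemma exists_interval_cover: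
  fixes m :: nat
  obtains S where "S \<subseteq> {..<m}" "card S \<le> (2 * m + 4) div 5"
    "\<And>x. x < m \<Longrightarrow> \<exists>s\<in>S. \<exists>d\<in>{0, 1, 3}. x = s + d"
proof
  \<comment> \<open>An element \<open>5 * i + 1\<close> serves only the points
    \<open>5 * i + 2\<close> and \<open>5 * i + 4\<close>, so it is kept only if
    \<open>5 * i + 2 < m\<close>. Keeping it for \<open>m = 5 * i + 2\<close> would exceed the bound
    by one.\<close>
  let ?A = "(\<lambda>i. 5 * i) ` {..<(m + 4) div 5}" and ?B = "(\<lambda>i. 5 * i + 1) ` {..<(m + 2) div 5}"
  show "?A \<union> ?B \<subseteq> {..<m}" by auto
  have "card (?A \<union> ?B) \<le> card ?A + card ?B" by (rule card_Un_le)
  also have "\<dots> \<le> (m + 4) div 5 + (m + 2) div 5"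
    by (intro add_mono) (metis card_image_le card_lessThan finite_lessThan)+
  also have "\<dots> = (2 * m + 4) div 5" by presburger
  finally show "card (?A \<union> ?B) \<le> (2 * m + 4) div 5" .
  fix x assume "x < m"
  define q r where "q = x div 5" and "r = x mod 5"
  have x: "x = 5 * q + r" and "r < 5" by (simp_all add: q_def r_def)
  from \<open>r < 5\<close> consider "r = 0" | "r = 1" | "r = 2" | "r = 3" | "r = 4" by linarith
  then show "\<exists>s\<in>?A \<union> ?B. \<exists>d\<in>{0, 1, 3}. x = s + d"
  proof cases
    case 1
    with x \<open>x < m\<close> have "5 * q \<in> ?A" by (intro image_eqI[of _ _ q]) auto
    with x 1 show ?thesis by (intro bexI[of _ "5 * q"] bexI[of _ 0] UnI1) auto
  next
    case 2
    with x \<open>x < m\<close> have "5 * q \<in> ?A" by (intro image_eqI[of _ _ q]) auto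
    with x 2 show ?thesis by (intro bexI[of _ "5 * q"] bexI[of _ 1] UnI1) auto
  next
    case 3
    with x \<open>x < m\<close> have "5 * q + 1 \<in> ?B" by (intro image_eqI[of _ _ q]) auto
    with x 3 show ?thesis by (intro bexI[of _ "5 * q + 1"] bexI[of _ 1] UnI2) auto
  next
    case 4
    with x \<open>x < m\<close> have "5 * q \<in> ?A" by (intro image_eqI[of _ _ q]) auto
    with x 4 show ?thesis by (intro bexI[of _ "5 * q"] bexI[of _ 3] UnI1) auto
  next
    case 5
    with x \<open>x < m\<close> have "5 * q + 1 \<in> ?B" by (intro image_eqI[of _ _ q]) auto
    with x 5 show ?thesis by (intro bexI[of _ "5 * q + 1"] bexI[of _ 3] UnI2) auto
  qed
qed

section \<open>Total domination as a pair of covers\<close>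

lemma knodel_edges_3:
  "knodel_edges 3 n =
    {{(1, j), (2, (j + d) mod (n div 2))} | j d. j < n div 2 \<and> d \<in> {0, 1, 3}}"
proof -
  have d_iff: "d \<in> {0, 1, 3} \<longleftrightarrow> (\<exists>k<3. d = 2 ^ k - 1)" for d :: nat
  proof -
    have "(\<exists>k<3. d = 2 ^ k - 1) \<longleftrightarrow> (\<exists>k\<in>{0, 1, 2::nat}. d = 2 ^ k - 1)"
      by (auto simp: numeral_3_eq_3 numeral_2_eq_2 less_Suc_eq)
    then show ?thesis by auto
  qed
  have diff_assoc: "j + 2 ^ k - 1 = j + (2 ^ k - 1)" for j k :: nat by simp
  show ?thesis unfolding knodel_edges_def d_iff diff_assoc
    by (intro Collect_cong iffI; elim exE conjE; intro exI conjI; simp only:)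
qed

text \<open>The graph is bipartite, so side 1 is dominated only from side 2 and conversely: the two
  conditions constrain disjoint parts of \<open>D\<close>.\<close>

lemma total_dominating_knodel_3_iff:
  "total_dominating_set (knodel_verts n) (knodel_edges 3 n) D \<longleftrightarrow>
    D \<subseteq> knodel_verts n \<and>
    (\<forall>x<n div 2. \<exists>d\<in>{0, 1, 3}. (2, (x + d) mod (n div 2)) \<in> D) \<and>
    (\<forall>x<n div 2. \<exists>j<n div 2. (1, j) \<in> D \<and> (\<exists>d\<in>{0, 1, 3}. x = (j + d) mod (n div 2)))"
proof -
  have 1: "adjacent (knodel_edges 3 n) (1, x) u \<longleftrightarrow>
      x < n div 2 \<and> (\<exists>d\<in>{0, 1, 3}. u = (2, (x + d) mod (n div 2)))" for x u
  proof -
    have *: "{(1, x), u} = {(1, j), (2, y)} \<longleftrightarrow> j = x \<and> u = (2, y)" for j y :: nat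
      by (auto simp: doubleton_eq_iff)
    show ?thesis unfolding adjacent_def knodel_edges_3 mem_Collect_eq * by blast
  qed
  have 2: "adjacent (knodel_edges 3 n) (2, x) u \<longleftrightarrow>
      (\<exists>j<n div 2. u = (1, j) \<and> (\<exists>d\<in>{0, 1, 3}. x = (j + d) mod (n div 2)))" for x u
  proof -
    have *: "{(2, x), u} = {(1, j), (2, y)} \<longleftrightarrow> u = (1, j) \<and> x = y" for j y :: nat
      by (auto simp: doubleton_eq_iff)
    show ?thesis unfolding adjacent_def knodel_edges_3 mem_Collect_eq * by blast
  qed
  have "(\<forall>v\<in>knodel_verts n. \<exists>u\<in>D. adjacent (knodel_edges 3 n) v u) \<longleftrightarrow>
      (\<forall>x<n div 2. \<exists>u\<in>D. adjacent (knodel_edges 3 n) (1, x) u) \<and>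
      (\<forall>x<n div 2. \<exists>u\<in>D. adjacent (knodel_edges 3 n) (2, x) u)"
    unfolding knodel_verts_def by auto
  also have "\<dots> \<longleftrightarrow> (\<forall>x<n div 2. \<exists>d\<in>{0, 1, 3}. (2, (x + d) mod (n div 2)) \<in> D) \<and>
    (\<forall>x<n div 2. \<exists>j<n div 2. (1, j) \<in> D \<and> (\<exists>d\<in>{0, 1, 3}. x = (j + d) mod (n div 2)))"
    unfolding 1 2 by blast
  finally show ?thesis unfolding total_dominating_set_def by blast
qed

lemma total_dominating_knodel_3_lower:
  assumes "n \<ge> 2" and D: "total_dominating_set (knodel_verts n) (knodel_edges 3 n) D"
  shows "2 * ((2 * (n div 2) + 4) div 5) \<le> card D"
proof -
  define m where "m = n div 2"
  define A where "A = {j. (1, j) \<in> D}"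
  define B where "B = {j. (2, j) \<in> D}"
  have "m > 0" using assms(1) by (simp add: m_def)
  have sub: "D \<subseteq> {1, 2} \<times> {..<m}"
    and domB: "\<And>x. x < m \<Longrightarrow> \<exists>d\<in>{0, 1, 3}. (x + d) mod m \<in> B"
    and domA: "\<And>x. x < m \<Longrightarrow> \<exists>j\<in>A. \<exists>d\<in>{0, 1, 3}. x = (j + d) mod m"
    using iffD1[OF total_dominating_knodel_3_iff D]
    unfolding knodel_verts_def A_def B_def m_def by blast+
  have subA: "A \<subseteq> {..<m}" and subB: "B \<subseteq> {..<m}" using sub by (auto simp: A_def B_def)
  then have fin: "finite A" "finite B" using finite_subset by blast+
  have "D = Pair 1 ` A \<union> Pair 2 ` B" using sub by (auto simp: A_def B_def)
  then have "card D = card (Pair (1::nat) ` A) + card (Pair (2::nat) ` B)"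
    using fin by (simp only:) (rule card_Un_disjoint, auto)
  then have card: "card D = card A + card B" by (simp add: card_image inj_on_def)
  have "2 * int m \<le> 5 * int (card (int ` A))"
  proof (rule cyclic_cover_bound[where e = 1])
    show "int ` A \<subseteq> {0..<int m}" using subA by auto
    fix x
    have "nat (x mod int m) < m" using \<open>m > 0\<close> by (simp add: nat_less_iff)
    from domA[OF this] obtain j d where jd: "j \<in> A" "d \<in> {0, 1, 3}" "nat (x mod int m) = (j + d) mod m"
      by blast
    then have "x mod int m = (int j + int d) mod int m"
      using \<open>m > 0\<close> by (metis of_nat_add of_nat_mod nat_0_le pos_mod_sign of_nat_0_less_iff)
    then have "(x - int d) mod int m = int j mod int m"
      by (metis add_diff_cancel_right' mod_diff_left_eq)
    also have "\<dots> = int j" using jd(1) subA by auto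
    finally show "\<exists>d\<in>{0, 1, 3}. (x - 1 * d) mod int m \<in> int ` A"
      using jd by (intro bexI[of _ "int d"]) auto
  qed (use \<open>m > 0\<close> in simp)
  moreover have "2 * int m \<le> 5 * int (card (int ` B))"
  proof (rule cyclic_cover_bound[where e = "- 1"])
    show "int ` B \<subseteq> {0..<int m}" using subB by auto
    fix x
    have "nat (x mod int m) < m" using \<open>m > 0\<close> by (simp add: nat_less_iff)
    from domB[OF this] obtain d where d: "d \<in> {0, 1, 3}" "(nat (x mod int m) + d) mod m \<in> B"
      by blast
    have "int ((nat (x mod int m) + d) mod m) = (x + int d) mod int m"
      using \<open>m > 0\<close> by (simp add: of_nat_mod mod_add_left_eq)
    then have "(x + int d) mod int m \<in> int ` B" using d(2) by (metis imageI)
    then show "\<exists>d\<in>{0, 1, 3}. (x - - 1 * d) mod int m \<in> int ` B"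
      using d(1) by (intro bexI[of _ "int d"]) auto
  qed (use \<open>m > 0\<close> in simp)
  ultimately have "2 * m \<le> 5 * card A" "2 * m \<le> 5 * card B" by (simp_all add: card_image)
  \<comment> \<open>Rounding up is done on each side before adding, which is stronger than rounding
    \<open>4 * m / 5\<close>.\<close>
  then have "(2 * m + 4) div 5 \<le> card A" "(2 * m + 4) div 5 \<le> card B" by linarith+
  then show ?thesis unfolding card m_def[symmetric] by simp
qed

lemma total_dominating_knodel_3_exists:
  obtains D where "total_dominating_set (knodel_verts n) (knodel_edges 3 n) D"
    "card D \<le> 2 * ((2 * (n div 2) + 4) div 5)"
proof -
  define m where "m = n div 2"
  obtain S where S: "S \<subseteq> {..<m}" "card S \<le> (2 * m + 4) div 5"
    and cover: "\<And>x. x < m \<Longrightarrow> \<exists>s\<in>S. \<exists>d\<in>{0, 1, 3}. x = s + d"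
    by (rule exists_interval_cover[of m]) blast
  \<comment> \<open>Reflecting the interval turns \<open>x = s + d\<close> into
    \<open>x + d = t\<close>, the form that side 2 requires.\<close>
  define T where "T = (\<lambda>s. m - 1 - s) ` S"
  have finS: "finite S" using S(1) finite_subset by blast
  have T: "T \<subseteq> {..<m}" using S(1) by (auto simp: T_def)
  have coverT: "\<exists>d\<in>{0, 1, 3}. (x + d) mod m \<in> T" if "x < m" for x
  proof -
    have "m - 1 - x < m" using that by simp
    from cover[OF this] obtain s d where sd: "s \<in> S" "d \<in> {0, 1, 3}" "m - 1 - x = s + d" by blast
    then have "x + d = m - 1 - s" using that by linarith
    then have "(x + d) mod m \<in> T" using sd(1) that by (simp add: T_def)
    with sd(2) show ?thesis by blast
  qed
  define D where "D = Pair (1::nat) ` S \<union> Pair (2::nat) ` T"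
  have "\<exists>j<m. j \<in> S \<and> (\<exists>d\<in>{0, 1, 3}. x = (j + d) mod m)" if x: "x < m" for x
  proof -
    from cover[OF x] obtain s d where sd: "s \<in> S" "d \<in> {0, 1, 3}" "x = s + d" by blast
    then have "x = (s + d) mod m" using x by simp
    with sd S(1) show ?thesis by blast
  qed
  moreover have mem: "(1, j) \<in> D \<longleftrightarrow> j \<in> S" "(2, j) \<in> D \<longleftrightarrow> j \<in> T" for j
    by (auto simp: D_def)
  moreover have "D \<subseteq> knodel_verts n"
    using S(1) T by (auto simp: D_def knodel_verts_def m_def)
  ultimately have "total_dominating_set (knodel_verts n) (knodel_edges 3 n) D"
    using coverT unfolding total_dominating_knodel_3_iff m_def[symmetric] mem by blast
  moreover have "card D \<le> 2 * ((2 * m + 4) div 5)"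
  proof -
    have "card D \<le> card (Pair (1::nat) ` S) + card (Pair (2::nat) ` T)"
      unfolding D_def by (rule card_Un_le)
    also have "\<dots> = card S + card T" by (simp add: card_image inj_on_def)
    also have "card T \<le> card S" unfolding T_def by (rule card_image_le[OF finS])
    finally show ?thesis using S(2) by linarith
  qed
  ultimately show ?thesis using that unfolding m_def by blast
qed

section \<open>Evaluation of the minimum\<close>

theorem theorem3p1:
  fixes n :: nat
  assumes "even n" and "n \<ge> 8"
  shows "int (total_domination_number (knodel_verts n) (knodel_edges 3 n)) =
    4 * \<lceil>real n / 10\<rceil> - (if n mod 10 \<in> {0, 6, 8} then 0 else 2)"
proof -
  have "n \<ge> 2" using assms(2) by simp
  note lower = total_dominating_knodel_3_lower[OF this]
  obtain D where D: "total_dominating_set (knodel_verts n) (knodel_edges 3 n) D"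
    and "card D \<le> 2 * ((2 * (n div 2) + 4) div 5)"
    by (rule total_dominating_knodel_3_exists)
  with lower[OF D] have "card D = 2 * ((2 * (n div 2) + 4) div 5)" by simp
  with D lower have "total_domination_number (knodel_verts n) (knodel_edges 3 n) =
      2 * ((2 * (n div 2) + 4) div 5)"
    unfolding total_domination_number_def by (intro Least_equality) blast+
  then have num: "total_domination_number (knodel_verts n) (knodel_edges 3 n) =
      2 * ((n + 4) div 5)"
    using assms(1) by simp
  have "\<lceil>real n / 10\<rceil> = int ((n + 9) div 10)"
    by (rule ceiling_unique) linarith+
  moreover have "int (2 * ((n + 4) div 5)) =
      4 * int ((n + 9) div 10) - (if n mod 10 \<in> {0, 6, 8} then 0 else 2)"
  proof -
    \<comment> \<open>For \<open>r\<close> = 0, 2, 4, 6, 8 the left side is \<open>4 * q\<close>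
      plus 0, 2, 2, 4, 4, while \<open>4 * ((n + 9) div 10)\<close> is \<open>4 * q\<close> plus 0,
      4, 4, 4, 4.\<close>
    define q r where "q = n div 10" and "r = n mod 10"
    have n: "n = 10 * q + r" by (simp add: q_def r_def)
    have "r < 10" "even r" using assms(1) by (simp_all add: r_def dvd_mod)
    then have "r = 0 \<or> r = 2 \<or> r = 4 \<or> r = 6 \<or> r = 8" by presburger
    moreover have "(n + 4) div 5 = 2 * q + (r + 4) div 5" "(n + 9) div 10 = q + (r + 9) div 10"
      unfolding n by linarith+
    ultimately show ?thesis unfolding r_def[symmetric] by (elim disjE) simp_all
  qed
  ultimately show ?thesis unfolding num by simp
qed

end
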